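(* Let $m>1$ be a squarefree integer, $\mathbb{K}=\mathbb{Q}(\sqrt{m})$, and let $\sigma$ be the generator of $\mathrm{Gal}(\mathbb{K}/\mathbb{Q})$. Let $0<\theta<\pi$ with $\cos\theta=s/r$, where $r,s$ are integers with $0<|s|<r$ and $\gcd(r,s)=1$. Assume that the positive integer $n$ is not a $\theta$-congruent number over $\mathbb{Q}$. Then any $(\mathbb{K},\theta,n)$-triangle $(U,V,W)_\theta$ with $(U,V,W)\in(\mathbb{K}^* )^3$ and $0<U\leq V<W$ is necessarily of one of the following types: Type 1. $U\sqrt{m},\ V\sqrt{m},\ W\sqrt{m}\in\mathbb{Q}$; Type 2. $U,\ V,\ W\sqrt{m}\in\mathbb{Q}$; Type 3. $U,V\in\mathbb{K}\setminus\mathbb{Q}$ such that $\sigma(U)=V$, and $W\in\mathbb{Q}$; Type 4. $U,V\in\mathbb{K}\setminus\mathbb{Q}$ such that $\sigma(U)=-V$, and $W\in\mathbb{Q}$.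
   Context: Put $\alpha_\theta=\sqrt{r^2-s^2}$. The field $\mathbb{K}$ is regarded as a subfield of $\mathbb{R}$ with $\sqrt m>0$. $(U,V,W)_\theta$ denotes a triangle with side lengths $U,V,W$ and with angle $\theta$ between the sides $U$ and $V$. A positive integer $n$ is a $\theta$-congruent number over $\mathbb{Q}$ if there is a triangle $(U,V,W)_\theta$ with sides in $\mathbb{Q}$ and area $n\alpha_\theta$. A $(\mathbb{K},\theta,n)$-triangle is a triangle $(U,V,W)_\theta$ with sides in $\mathbb{K}$ and area $n\alpha_\theta$; equivalently, $U,V,W\in\mathbb{K}$ are positive with $UV=2rn$ and $W^2=U^2+V^2-\frac{2s}{r}UV$ (and similarly over $\mathbb{Q}$). *)

theory Defs
  imports
    "HOL-Analysis.Analysis"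
    "HOL-Algebra.Bij"
    "HOL-Algebra.Generated_Groups"
    "HOL-Algebra.Generated_Fields"
    "HOL-Algebra.Algebraic_Closure_Type"
    "HOL-Computational_Algebra.Squarefree"
begin

abbreviation real_ring :: "real ring" where
  "real_ring \<equiv> ring_of_type_algebra"

definition quadratic_field :: "int \<Rightarrow> real set" where
  "quadratic_field m = generate_field real_ring (insert (sqrt (of_int m)) \<rat>)"

(* Automorphisms of L are taken as extensional functions (value undefined outside L), so that
   each automorphism is a single element of the carrier. *)
definition galois_group :: "real set \<Rightarrow> real set \<Rightarrow> (real \<Rightarrow> real) monoid" where
  "galois_group L F =
     BijGroup L \<lparr>carrier :=
       {\<sigma> \<in> Bij L. \<sigma> \<in> ring_iso (real_ring \<lparr>carrier := L\<rparr>) (real_ring \<lparr>carrier := L\<rparr>) \<and>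
                   (\<forall>x\<in>F. \<sigma> x = x)}\<rparr>"

definition is_group_generator :: "('a, 'b) monoid_scheme \<Rightarrow> 'a \<Rightarrow> bool" where
  "is_group_generator G g \<longleftrightarrow> g \<in> carrier G \<and> generate G {g} = carrier G"

definition angle_at :: "real ^ 2 \<Rightarrow> real ^ 2 \<Rightarrow> real ^ 2 \<Rightarrow> real" where
  "angle_at C A B = arccos (((A - C) \<bullet> (B - C)) / (norm (A - C) * norm (B - C)))"

(* A, B, C are the vertices of a triangle (U, V, W)_theta; C is the common vertex of the
   sides U and V. *)
definition triangle_with_angle ::
  "real \<Rightarrow> real \<Rightarrow> real \<Rightarrow> real \<Rightarrow> real ^ 2 \<Rightarrow> real ^ 2 \<Rightarrow> real ^ 2 \<Rightarrow> bool" where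
  "triangle_with_angle \<theta> U V W A B C \<longleftrightarrow>
     \<not> collinear {A, B, C} \<and>
     dist C A = U \<and> dist C B = V \<and> dist A B = W \<and> angle_at C A B = \<theta>"

(* This is alpha_theta, as a function of the r and s with cos theta = s / r. *)
definition alpha :: "int \<Rightarrow> int \<Rightarrow> real" where
  "alpha r s = sqrt (of_int (r\<^sup>2 - s\<^sup>2))"

(* (U, V, W) is an (F, theta, n)-triangle, where cos theta = s / r. *)
definition field_theta_triangle ::
  "real set \<Rightarrow> real \<Rightarrow> int \<Rightarrow> int \<Rightarrow> nat \<Rightarrow> real \<Rightarrow> real \<Rightarrow> real \<Rightarrow> bool" where
  "field_theta_triangle F \<theta> r s n U V W \<longleftrightarrow>
     U \<in> F \<and> V \<in> F \<and> W \<in> F \<and>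
     (\<exists>A B C. triangle_with_angle \<theta> U V W A B C \<and>
              measure lborel (convex hull {A, B, C}) = real n * alpha r s)"

definition theta_congruent :: "real \<Rightarrow> int \<Rightarrow> int \<Rightarrow> nat \<Rightarrow> bool" where
  "theta_congruent \<theta> r s n \<longleftrightarrow> n > 0 \<and> (\<exists>U V W. field_theta_triangle \<rat> \<theta> r s n U V W)"

end

(*  A triangle (U, V, W) with angle theta and area n alpha gives the point (x, U x) with
    2 x = U (U + W) - 2 s n on the elliptic curve y^2 = x (x + (r + s) n) (x - (r - s) n), and a
    rational point with y different from 0 gives back a rational triangle.  If n is not
    theta-congruent, all rational points therefore have y = 0.  For a point P over K the point
    P + sigma P is rational, so it is the point at infinity or one of the three points with y = 0;
    the four possibilities are the four types.  *)
theory Submission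
  imports Defs
begin

text \<open>Put \<open>p = (r + s) n\<close> and \<open>q = (r - s) n\<close>. A triangle is then a
  positive solution of \<open>U V = p + q\<close>, \<open>W^2 = (U + V)^2 - 4 p\<close>, and its
  point P has \<open>y / x = U\<close>. For T of order dividing 2, the map sending P to T - P acts
  on solutions by one of four sign changes or swaps: (-U, -V, -W) for T = O, (U, V, -W) for T = (0,
  0), (-V, -U, W) for T = (-p, 0) and (V, U, W) for T = (q, 0). Now P + \<sigma> P = T says that
  \<sigma> acts on the sides by exactly this map, so each T yields one type. The group law itself is
  avoided: the third intersection of the chord through P and \<sigma> P, which is -(P + \<sigma> P),
  does its work.\<close>

section \<open>Rational points and conjugate points on the curve\<close>

text \<open>Collects what the argument on the curve needs from the field and its conjugation, free
  of \<open>generate_field\<close> and \<open>galois_group\<close>. The intended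
  \<open>\<delta>\<close> is the square root of \<open>m\<close>; it turns elements negated by
  \<open>\<sigma>\<close> into rationals.\<close>

locale quadratic_conjugation =
  fixes K :: "real set" and \<sigma> :: "real \<Rightarrow> real" and \<delta> :: real
  assumes Rats_subset: "\<rat> \<subseteq> K"
    and add_closed: "\<lbrakk>x \<in> K; y \<in> K\<rbrakk> \<Longrightarrow> x + y \<in> K"
    and mult_closed: "\<lbrakk>x \<in> K; y \<in> K\<rbrakk> \<Longrightarrow> x * y \<in> K"
    and inverse_closed: "x \<in> K \<Longrightarrow> inverse x \<in> K"
    and conj_closed: "x \<in> K \<Longrightarrow> \<sigma> x \<in> K"
    and conj_add: "\<lbrakk>x \<in> K; y \<in> K\<rbrakk> \<Longrightarrow> \<sigma> (x + y) = \<sigma> x + \<sigma> y"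
    and conj_mult: "\<lbrakk>x \<in> K; y \<in> K\<rbrakk> \<Longrightarrow> \<sigma> (x * y) = \<sigma> x * \<sigma> y"
    and conj_conj: "x \<in> K \<Longrightarrow> \<sigma> (\<sigma> x) = x"
    and fixed_iff: "x \<in> K \<Longrightarrow> \<sigma> x = x \<longleftrightarrow> x \<in> \<rat>"
    and root_in: "\<delta> \<in> K"
    and conj_root: "\<sigma> \<delta> = - \<delta>"
begin

lemma Rats_in: "x \<in> \<rat> \<Longrightarrow> x \<in> K"
  using Rats_subset by blast

lemma conj_Rats: "x \<in> \<rat> \<Longrightarrow> \<sigma> x = x"
  using Rats_in fixed_iff by blast

lemma minus_closed: "x \<in> K \<Longrightarrow> - x \<in> K"
  using mult_closed[of "-1" x] Rats_in[of "-1"] by simp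

lemma conj_minus: "x \<in> K \<Longrightarrow> \<sigma> (- x) = - \<sigma> x"
  using conj_mult[of "-1" x] Rats_in[of "-1"] conj_Rats[of "-1"] by simp

lemma diff_closed: "\<lbrakk>x \<in> K; y \<in> K\<rbrakk> \<Longrightarrow> x - y \<in> K"
  using add_closed[of x "- y"] minus_closed by simp

lemma conj_diff: "\<lbrakk>x \<in> K; y \<in> K\<rbrakk> \<Longrightarrow> \<sigma> (x - y) = \<sigma> x - \<sigma> y"
  using conj_add[of x "- y"] minus_closed conj_minus by simp

lemma conj_inverse:
  assumes "x \<in> K"
  shows "\<sigma> (inverse x) = inverse (\<sigma> x)"
proof (cases "x = 0")
  case False
  have "\<sigma> x * \<sigma> (inverse x) = 1"
    using conj_mult[OF assms inverse_closed[OF assms]] conj_Rats[of 1] False by simp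
  then show ?thesis
    by (metis inverse_unique)
qed (simp add: conj_Rats)

lemma divide_closed: "\<lbrakk>x \<in> K; y \<in> K\<rbrakk> \<Longrightarrow> x / y \<in> K"
  by (simp add: divide_inverse mult_closed inverse_closed)

lemma conj_divide: "\<lbrakk>x \<in> K; y \<in> K\<rbrakk> \<Longrightarrow> \<sigma> (x / y) = \<sigma> x / \<sigma> y"
  by (simp add: divide_inverse conj_mult inverse_closed conj_inverse)

lemmas closed = Rats_in add_closed mult_closed diff_closed divide_closed conj_closed minus_closed

lemmas conj_simps = conj_add conj_mult conj_diff conj_divide conj_conj conj_Rats conj_minus

lemma conj_eq_minus_if_square_rational:
  assumes "x \<in> K" "x * x \<in> \<rat>" "x \<notin> \<rat>"
  shows "\<sigma> x = - x"
proof -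
  have "\<sigma> x * \<sigma> x = x * x"
    using assms conj_mult[of x x] conj_Rats by simp
  then have "\<sigma> x = x \<or> \<sigma> x = - x"
    by (simp add: square_eq_iff)
  then show ?thesis
    using assms fixed_iff by blast
qed

lemma mult_root_rational:
  assumes "x \<in> K" "\<sigma> x = - x"
  shows "x * \<delta> \<in> \<rat>"
proof -
  have "\<sigma> (x * \<delta>) = x * \<delta>"
    using assms root_in conj_root by (simp add: conj_mult)
  then show ?thesis
    using assms root_in fixed_iff mult_closed by blast
qed

end

text \<open>The map from triangles to points is inverted: \<open>u = y / x\<close>, then
  \<open>v = (p + q) / u\<close> and \<open>w = (x + p q / x) / u\<close>, up to signs.\<close>

lemma rational_point_trivial:
  fixes p q x y :: real
  assumes "p > 0" "q > 0" "p \<in> \<rat>" "q \<in> \<rat>" "x \<in> \<rat>" "y \<in> \<rat>"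
    and curve: "y\<^sup>2 = x * (x + p) * (x - q)"
    and no_triangle: "\<And>u v w. \<lbrakk>u \<in> \<rat>; v \<in> \<rat>; w \<in> \<rat>; u > 0; v > 0; w > 0; u * v = p + q;
        w\<^sup>2 = (u + v)\<^sup>2 - 4 * p\<rbrakk> \<Longrightarrow> False"
  shows "y = 0"
proof (rule ccontr)
  assume y: "y \<noteq> 0"
  define a where "a = (x + p) * (x - q)"
  have xa: "x * a = y\<^sup>2"
    using curve by (simp add: a_def algebra_simps)
  then have pos: "x * a > 0"
    using y by simp
  \<comment> \<open>On the curve \<open>y / x = a / y\<close>, which gives these quotients. Since
    \<open>x * a\<close> is a nonzero square, \<open>x\<close> and \<open>a\<close> have the same
    sign, so the absolute values make all sides positive without changing \<open>u * v\<close> or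
    any square.\<close>
  define u v w where "u = \<bar>a\<bar> / \<bar>y\<bar>" and "v = (p + q) * \<bar>x\<bar> / \<bar>y\<bar>" and "w = (x\<^sup>2 + p * q) / \<bar>y\<bar>"
  have abs: "\<bar>x\<bar> * \<bar>a\<bar> = y\<^sup>2"
    using xa pos by (simp flip: abs_mult)
  have rat: "u \<in> \<rat>" "v \<in> \<rat>" "w \<in> \<rat>"
    using assms(3-6) unfolding u_def v_def w_def a_def by auto
  have "x \<noteq> 0" "a \<noteq> 0"
    using pos by auto
  then have gt: "u > 0" "v > 0" "w > 0"
    using assms(1,2) y unfolding u_def v_def w_def by (simp_all add: add_nonneg_pos)
  have "u * v = (p + q) * (\<bar>x\<bar> * \<bar>a\<bar>) / \<bar>y\<bar>\<^sup>2"
    unfolding u_def v_def by (simp add: power2_eq_square)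
  then have uv: "u * v = p + q"
    using y unfolding abs by simp
  have "u\<^sup>2 + v\<^sup>2 = (a\<^sup>2 + (p + q)\<^sup>2 * x\<^sup>2) / y\<^sup>2"
    using y unfolding u_def v_def by (simp add: power_divide power_mult_distrib add_divide_distrib)
  \<comment> \<open>Completing the square: \<open>a - (p - q) * x\<close> is
    \<open>x\<^sup>2 - p * q\<close>, whose square differs from the left side by
    \<open>4 * p * q * x\<^sup>2\<close>.\<close>
  moreover have "(x\<^sup>2 + p * q)\<^sup>2 = a\<^sup>2 + (p + q)\<^sup>2 * x\<^sup>2 - 2 * (p - q) * (x * a)"
    unfolding a_def by (simp add: algebra_simps power2_eq_square)
  ultimately have "w\<^sup>2 = u\<^sup>2 + v\<^sup>2 - 2 * (p - q)"
    using y unfolding w_def xa by (simp add: power_divide field_simps)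
  also have "\<dots> = (u + v)\<^sup>2 - 4 * p"
    using uv by (simp add: power2_eq_square algebra_simps)
  finally show False
    using no_triangle rat gt uv by blast
qed

text \<open>Vieta: the cubic minus the squared line is monic with roots \<open>x1\<close>,
  \<open>x2\<close>, \<open>x3\<close>. The choice of \<open>x3\<close> fixes the sum of the roots;
  the other two coefficients have to be recovered.\<close>

lemma third_intersection_on_cubic:
  fixes x1 x2 x3 A B l c :: real
  assumes "x1 \<noteq> x2" "(l * x1 + c)\<^sup>2 = x1 ^ 3 + A * x1\<^sup>2 + B * x1"
    "(l * x2 + c)\<^sup>2 = x2 ^ 3 + A * x2\<^sup>2 + B * x2" "x3 = l\<^sup>2 - A - x1 - x2"
  shows "(l * x3 + c)\<^sup>2 = x3 ^ 3 + A * x3\<^sup>2 + B * x3"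
proof -
  \<comment> \<open>The divided difference of cubic minus squared line at the two known roots; it
    determines \<open>2 * l * c\<close>, and evaluation at \<open>x1\<close> then determines
    \<open>c\<^sup>2\<close>.\<close>
  have "(x1 - x2) * ((x1\<^sup>2 + x1 * x2 + x2\<^sup>2) + A * (x1 + x2) + B - l\<^sup>2 * (x1 + x2) - 2 * l * c)
      = (x1 ^ 3 + A * x1\<^sup>2 + B * x1 - (l * x1 + c)\<^sup>2) - (x2 ^ 3 + A * x2\<^sup>2 + B * x2 - (l * x2 + c)\<^sup>2)"
    by (simp add: algebra_simps power2_eq_square power3_eq_cube)
  also have "\<dots> = 0"
    using assms(2,3) by simp
  finally have dd: "(x1\<^sup>2 + x1 * x2 + x2\<^sup>2) + A * (x1 + x2) + B - l\<^sup>2 * (x1 + x2) - 2 * l * c = 0"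
    using assms(1) by simp
  have l2: "l\<^sup>2 = x3 + A + x1 + x2"
    using assms(4) by simp
  have lc: "2 * l * c = B - (x1 * x2 + x3 * (x1 + x2))"
    using dd unfolding l2 by (simp add: algebra_simps power2_eq_square)
  have expand: "(l * t + c)\<^sup>2 = l\<^sup>2 * t\<^sup>2 + (2 * l * c) * t + c\<^sup>2" for t
    by (simp add: algebra_simps power2_eq_square)
  have c2: "c\<^sup>2 = x1 * x2 * x3"
    using assms(2) unfolding expand lc l2
    by (simp add: algebra_simps power2_eq_square power3_eq_cube)
  show ?thesis
    unfolding expand lc l2 c2 by (simp add: algebra_simps power2_eq_square power3_eq_cube)
qed

section \<open>The four types from the chord through a point and its conjugate\<close>

context quadratic_conjugation
begin

text \<open>The theorem without geometry. Rational \<open>x\<close> gives type 1; otherwise the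
  chord meets the curve again at abscissa 0, \<open>- p\<close> or \<open>q\<close>, giving types 2,
  4 and 3.\<close>

lemma triangle_types:
  fixes p q U V W :: real
  assumes pq: "p > 0" "q > 0" "p \<in> \<rat>" "q \<in> \<rat>"
    and no_triangle: "\<And>u v w. \<lbrakk>u \<in> \<rat>; v \<in> \<rat>; w \<in> \<rat>; u > 0; v > 0; w > 0; u * v = p + q;
        w\<^sup>2 = (u + v)\<^sup>2 - 4 * p\<rbrakk> \<Longrightarrow> False"
    and K: "U \<in> K" "V \<in> K" "W \<in> K"
    and pos: "U > 0" "V > 0" "W > 0"
    and UV: "U * V = p + q"
    and W2: "W\<^sup>2 = (U + V)\<^sup>2 - 4 * p"
  shows "(U * \<delta> \<in> \<rat> \<and> V * \<delta> \<in> \<rat> \<and> W * \<delta> \<in> \<rat>)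
       \<or> (U \<in> \<rat> \<and> V \<in> \<rat> \<and> W * \<delta> \<in> \<rat>)
       \<or> (U \<in> K - \<rat> \<and> V \<in> K - \<rat> \<and> \<sigma> U = V \<and> W \<in> \<rat>)
       \<or> (U \<in> K - \<rat> \<and> V \<in> K - \<rat> \<and> \<sigma> U = - V \<and> W \<in> \<rat>)"
proof -
  \<comment> \<open>The double of \<open>(x, U x)\<close> has abscissa \<open>W\<^sup>2 / 4\<close>, the usual point attached to the triangle.\<close>
  define x where "x = (U * (U + W) - (p - q)) / 2"
  have x: "2 * x = U * (U + W) - (p - q)"
    by (simp add: x_def)
  have xK: "x \<in> K"
    unfolding x_def using K pq by (simp add: closed)
  have V: "V = (p + q) / U"
    using UV pos by (simp add: field_simps)
  have W: "W = (2 * x - U * U + p - q) / U"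
    using x pos by (simp add: field_simps)
  \<comment> \<open>In terms of the sides, \<open>4 * x\<close> is
    \<open>(U + W)\<^sup>2 - V\<^sup>2\<close>, and its two linear factors times \<open>U\<close>
    are \<open>2 * (x + p)\<close> and \<open>2 * (x - q)\<close>.\<close>
  have U2: "U\<^sup>2 * x = (x + p) * (x - q)"
  proof -
    have "4 * ((x + p) * (x - q)) = (2 * (x + p)) * (2 * (x - q))"
      by (simp only: mult_ac)
    also have "2 * (x + p) = U * (U + V + W)"
      using x UV by (simp add: algebra_simps)
    also have "2 * (x - q) = U * (U + W - V)"
      using x UV by (simp add: algebra_simps)
    also have "(U * (U + V + W)) * (U * (U + W - V)) = U\<^sup>2 * ((U + W)\<^sup>2 - V\<^sup>2)"
      by (simp add: algebra_simps power2_eq_square)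
    also have "(U + W)\<^sup>2 - V\<^sup>2 = 4 * x"
      using x UV W2 by (simp add: algebra_simps power2_eq_square)
    finally show ?thesis by simp
  qed
  have x0: "x \<noteq> 0"
    using U2 pq by auto
  have curve: "(U * x)\<^sup>2 = x * (x + p) * (x - q)"
    using U2 by Groebner_Basis.algebra
  note trivial = rational_point_trivial[OF pq _ _ _ no_triangle]
  show ?thesis
  proof (cases "x \<in> \<rat>")
    case True
    \<comment> \<open>Here the conjugate point is P or -P; it cannot be P, as P would be a rational
      point with nonzero ordinate \<open>U * x\<close>.\<close>
    have U: "U \<notin> \<rat>"
      using trivial[OF True _ curve] True x0 pos by auto
    have "U * U = (x + p) * (x - q) / x"
      using U2 x0 by (simp add: field_simps power2_eq_square)
    also have "\<dots> \<in> \<rat>"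
      using True pq by simp
    finally have U2_rat: "U * U \<in> \<rat>" .
    then have sU: "\<sigma> U = - U"
      using conj_eq_minus_if_square_rational K(1) U by blast
    have "\<sigma> V = - V"
      using V sU K(1) pq by (simp add: conj_divide conj_Rats closed)
    moreover have "\<sigma> W = - W"
    proof -
      have num: "2 * x - U * U + p - q \<in> \<rat>"
        using True U2_rat pq by simp
      show ?thesis
        unfolding W using sU K(1) num by (simp add: conj_divide conj_Rats closed)
    qed
    ultimately show ?thesis
      using sU K mult_root_rational by blast
  next
    case False
    define x' where "x' = \<sigma> x"
    have x'K: "x' \<in> K" and sx': "\<sigma> x' = x"
      using xK unfolding x'_def by (simp_all add: closed conj_conj)
    have ne: "x \<noteq> x'"
      using False xK fixed_iff unfolding x'_def by metis
    \<comment> \<open>Slope and intercept of the chord through P and its conjugate.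
      \<open>\<sigma>\<close> swaps the two points, so it fixes the line and both coefficients are
      rational.\<close>
    define l c where "l = (U * x - \<sigma> U * x') / (x - x')" and "c = U * x - l * x"
    have lK: "l \<in> K"
      unfolding l_def using K xK x'K by (simp add: closed)
    have "\<sigma> l = (\<sigma> U * x' - U * x) / (x' - x)"
      unfolding l_def using K xK x'K sx' by (simp add: conj_simps closed flip: x'_def)
    also have "\<dots> = l"
      unfolding l_def by (metis minus_diff_eq minus_divide_divide)
    finally have l: "l \<in> \<rat>"
      using fixed_iff lK by blast
    have slope: "l * (x - x') = U * x - \<sigma> U * x'"
      using ne by (simp add: l_def)
    have c': "c = \<sigma> U * x' - l * x'"
      using slope by (simp add: c_def algebra_simps)
    have "\<sigma> c = c"
      unfolding c_def using K xK l
      by (simp add: conj_simps closed flip: x'_def) (simp add: c'[unfolded c_def])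
    moreover have "c \<in> K"
      unfolding c_def using K xK lK by (simp add: closed)
    ultimately have c: "c \<in> \<rat>"
      using fixed_iff by blast
    have sum_rat: "x + x' \<in> \<rat>"
    proof -
      have "\<sigma> (x + x') = x + x'"
        using xK x'K sx' by (simp add: conj_add flip: x'_def)
      then show ?thesis
        using fixed_iff xK x'K add_closed by blast
    qed
    define x3 where "x3 = l\<^sup>2 - (p - q) - x - x'"
    have x3_rat: "x3 \<in> \<rat>"
    proof -
      have "x3 = l\<^sup>2 - (p - q) - (x + x')"
        by (simp add: x3_def)
      then show ?thesis
        using l pq sum_rat by simp
    qed
    have on1: "(l * x + c)\<^sup>2 = x ^ 3 + (p - q) * x\<^sup>2 + (- p * q) * x"
      using curve unfolding c_def by Groebner_Basis.algebra
    have "\<sigma> ((U * x) * (U * x)) = \<sigma> (x * (x + p) * (x - q))"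
      using curve by (simp only: power2_eq_square)
    then have "(\<sigma> U * x') * (\<sigma> U * x') = x' * (x' + p) * (x' - q)"
      using K xK pq by (simp add: conj_simps closed flip: x'_def)
    then have on2: "(l * x' + c)\<^sup>2 = x' ^ 3 + (p - q) * x'\<^sup>2 + (- p * q) * x'"
      unfolding c' by Groebner_Basis.algebra
    have on3: "(l * x3 + c)\<^sup>2 = x3 * (x3 + p) * (x3 - q)"
      using third_intersection_on_cubic[OF ne on1 on2 x3_def] by Groebner_Basis.algebra
    \<comment> \<open>The third intersection is a rational point, hence lies on the axis.\<close>
    have y3: "l * x3 + c = 0"
      using trivial[OF x3_rat _ on3] l c x3_rat by simp
    have cases: "x3 = 0 \<or> x3 = - p \<or> x3 = q"
      using on3 unfolding y3 by auto
    have Ux: "U * x = l * (x - x3)"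
      using y3 by (simp add: c_def algebra_simps)
    have l0: "l \<noteq> 0"
      using Ux pos x0 by auto
    \<comment> \<open>In the cases \<open>x3 = - p\<close> and \<open>x3 = q\<close>,
      \<open>x\<close> is such a rational affine function of \<open>U\<close>: irrationality passes
      from \<open>x\<close> to \<open>U\<close>, and conjugating the relation computes
      \<open>\<sigma> U\<close>.\<close>
    have irrational: "U \<in> K - \<rat> \<and> V \<in> K - \<rat>" if "x = l * U + e" "e \<in> \<rat>" for e
    proof -
      have U: "U \<notin> \<rat>"
        using that l False by auto
      have "U = (p + q) / V"
        using UV pos by (simp add: field_simps)
      then have "V \<notin> \<rat>"
        using U pq by auto
      then show ?thesis
        using U K by blast
    qed
    have sU_eq: "l * \<sigma> U = x' - e" if "x = l * U + e" "e \<in> \<rat>" for e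
    proof -
      have "x' = l * \<sigma> U + e"
        unfolding x'_def that(1) using that(2) l K by (simp add: conj_simps closed)
      then show ?thesis
        by simp
    qed
    from cases show ?thesis
    proof (elim disjE)
      assume "x3 = 0"
      \<comment> \<open>The chord passes through the origin, so its slope is \<open>y / x\<close>,
        which is \<open>U\<close>.\<close>
      then have "U = l"
        using Ux x0 by simp
      then have rat: "U \<in> \<rat>" "V \<in> \<rat>"
        using l V pq by auto
      have "W * W \<in> \<rat>"
        using W2 rat pq by (simp flip: power2_eq_square)
      moreover have "W \<notin> \<rat>"
        using no_triangle[OF rat _ pos UV W2] by blast
      ultimately show ?thesis
        using rat K mult_root_rational conj_eq_minus_if_square_rational by blast
    next
      assume e: "x3 = - p"
      have "l\<^sup>2 * (x + p) * (x + p) = x * (x - q) * (x + p)"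
        using Ux curve unfolding e by Groebner_Basis.algebra
      moreover have "x + p \<noteq> 0"
        using False pq by (metis Rats_minus_iff eq_neg_iff_add_eq_0)
      ultimately have l2: "l\<^sup>2 * (x + p) = x * (x - q)"
        by simp
      have "x * (l * U) = x * (x - q)"
        using Ux l2 unfolding e by Groebner_Basis.algebra
      then have lU: "x = l * U + q"
        using x0 by simp
      have x'_eq: "x' = l\<^sup>2 + q - x"
        using e by (simp add: x3_def)
      \<comment> \<open>Since \<open>x' - q = l\<^sup>2 - x\<close>, the right side is
        \<open>l\<^sup>2 * (x - q) - x * (x - q)\<close>, which by \<open>l2\<close> equals
        \<open>- l\<^sup>2 * (p + q)\<close>.\<close>
      have "(l\<^sup>2 * U) * \<sigma> U = (x' - q) * (x - q)"
        using sU_eq[OF lU] pq lU by Groebner_Basis.algebra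
      also have "\<dots> = (l\<^sup>2 * U) * (- V)"
        using l2 UV unfolding x'_eq by Groebner_Basis.algebra
      finally have "\<sigma> U = - V"
        unfolding mult_cancel_left using l0 pos by auto
      \<comment> \<open>Multiply the definition of \<open>x\<close> by \<open>l\<^sup>2\<close> and
        replace \<open>l * U\<close> by \<open>x - q\<close>; with \<open>l2\<close> this becomes
        \<open>l\<^sup>2 * U * W = (x - q) * (l\<^sup>2 + q)\<close>.\<close>
      moreover have "l\<^sup>2 * U * (l * W) = l\<^sup>2 * U * (l\<^sup>2 + q)"
        using x lU l2 by Groebner_Basis.algebra
      then have "l * W = l\<^sup>2 + q"
        unfolding mult_cancel_left using l0 pos by auto
      then have "W = (l\<^sup>2 + q) / l"
        using l0 by (simp add: field_simps)
      then have "W \<in> \<rat>"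
        using l pq by simp
      ultimately show ?thesis
        using irrational[OF lU] pq by blast
    next
      \<comment> \<open>Exchanging \<open>p\<close> and \<open>- q\<close> preserves the curve and
        the formula for \<open>x\<close> but negates \<open>p + q\<close>; so the previous case
        recurs with \<open>V\<close> in place of \<open>- V\<close>.\<close>
      assume e: "x3 = q"
      have "l\<^sup>2 * (x - q) * (x - q) = x * (x + p) * (x - q)"
        using Ux curve unfolding e by Groebner_Basis.algebra
      moreover have "x - q \<noteq> 0"
        using False pq by auto
      ultimately have l2: "l\<^sup>2 * (x - q) = x * (x + p)"
        by simp
      have "x * (l * U) = x * (x + p)"
        using Ux l2 unfolding e by Groebner_Basis.algebra
      then have lU: "x = l * U + - p"
        using x0 by simp
      have sU: "l * \<sigma> U = x' + p"
        using sU_eq[OF lU] pq by simp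
      have x'_eq: "x' = l\<^sup>2 - p - x"
        using e by (simp add: x3_def)
      have "(l\<^sup>2 * U) * \<sigma> U = (x' + p) * (x + p)"
        using sU lU by Groebner_Basis.algebra
      also have "\<dots> = (l\<^sup>2 * U) * V"
        using l2 UV unfolding x'_eq by Groebner_Basis.algebra
      finally have "\<sigma> U = V"
        unfolding mult_cancel_left using l0 pos by auto
      moreover have "l\<^sup>2 * U * (l * W) = l\<^sup>2 * U * (l\<^sup>2 - p)"
        using x lU l2 by Groebner_Basis.algebra
      then have "l * W = l\<^sup>2 - p"
        unfolding mult_cancel_left using l0 pos by auto
      then have "W = (l\<^sup>2 - p) / l"
        using l0 by (simp add: field_simps)
      then have "W \<in> \<rat>"
        using l pq by simp
      ultimately show ?thesis
        using irrational[OF lU] pq by simp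
    qed
  qed
qed

end

section \<open>Real quadratic fields\<close>

lemma sqrt_squarefree_irrational:
  fixes m :: int
  assumes "m > 1" "squarefree m"
  shows "sqrt (of_int m) \<notin> \<rat>"
proof
  assume "sqrt (of_int m) \<in> \<rat>"
  then obtain a b :: int where ab: "b > 0" "coprime a b" "sqrt (of_int m) = of_int a / of_int b"
    by (metis Rats_cases')
  then have "of_int m = (of_int a / of_int b :: real)\<^sup>2"
    using assms(1) by (metis of_int_0_le_iff order.strict_implies_order order.strict_trans
        real_sqrt_pow2 zero_less_one)
  then have "of_int (m * b\<^sup>2) = (of_int (a\<^sup>2) :: real)"
    using ab(1) by (simp add: field_simps power_divide)
  then have eq: "m * b\<^sup>2 = a\<^sup>2"
    using of_int_eq_iff by blast
  then have "b\<^sup>2 dvd a\<^sup>2"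
    by (metis dvd_triv_right)
  then have "is_unit b"
    using ab(2) by (meson coprime_common_divisor dvd_refl pow_divides_pow_iff zero_less_numeral)
  then have "m = a\<^sup>2"
    using eq ab(1) by simp
  then have "is_unit a"
    using assms(2) by (metis dvd_refl squarefreeD)
  then have "m = 1"
    using \<open>m = a\<^sup>2\<close> by (metis abs_1 power2_abs one_power2 zdvd1_eq)
  then show False
    using assms(1) by simp
qed

section \<open>Translation of the ring and Galois group operations into real arithmetic\<close>

lemma real_ring_minus: "\<ominus>\<^bsub>real_ring\<^esub> x = - x"
proof -
  interpret R: field real_ring by rule
  have "x \<oplus>\<^bsub>real_ring\<^esub> (- x) = \<zero>\<^bsub>real_ring\<^esub>" "x \<in> carrier real_ring" "- x \<in> carrier real_ring"
    by (simp_all add: ring_of_type_algebra_def)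
  then show ?thesis
    using R.minus_equality R.a_comm by metis
qed

lemma real_ring_inv:
  assumes "x \<noteq> 0"
  shows "inv\<^bsub>real_ring\<^esub> x = inverse x"
proof -
  interpret R: field real_ring by rule
  have "x \<otimes>\<^bsub>real_ring\<^esub> inverse x = \<one>\<^bsub>real_ring\<^esub>" "x \<in> carrier real_ring"
      "inverse x \<in> carrier real_ring"
    using assms by (simp_all add: ring_of_type_algebra_def)
  then show ?thesis
    using R.comm_inv_char by metis
qed

lemma galois_group_carrier:
  "f \<in> carrier (galois_group L F) \<longleftrightarrow>
     f \<in> extensional L \<and> bij_betw f L L \<and> f 1 = 1
     \<and> (\<forall>x\<in>L. \<forall>y\<in>L. f (x + y) = f x + f y \<and> f (x * y) = f x * f y) \<and> (\<forall>x\<in>F. f x = x)"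
  unfolding galois_group_def Bij_def ring_iso_def ring_hom_def
  by (auto simp: ring_of_type_algebra_def bij_betw_def)

context
  fixes m :: int and d :: real
  assumes m: "m > 1" "squarefree m" and d_eq: "d = sqrt (of_int m)"
begin

lemma d_square: "d * d = of_int m"
  using m(1) d_eq by simp

lemma coords_mult:
  "(a + b * d) * (a' + b' * d) = (a * a' + b * b' * of_int m) + (a * b' + a' * b) * d"
  unfolding d_square[symmetric] by (simp add: algebra_simps)

lemma rational_coords_unique:
  assumes "a \<in> \<rat>" "b \<in> \<rat>" "a' \<in> \<rat>" "b' \<in> \<rat>" "a + b * d = a' + b' * d"
  shows "a = a' \<and> b = b'"
proof -
  have "b = b'"
  proof (rule ccontr)
    assume "b \<noteq> b'"
    then have "d = (a' - a) / (b - b')"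
      using assms(5) by (simp add: field_simps)
    then have "d \<in> \<rat>"
      using assms by simp
    then show False
      using sqrt_squarefree_irrational[OF m] d_eq by blast
  qed
  then show ?thesis
    using assms(5) by simp
qed

lemma inverse_coords:
  assumes "a \<in> \<rat>" "b \<in> \<rat>" "a + b * d \<noteq> 0"
  shows "inverse (a + b * d) = a / (a\<^sup>2 - b\<^sup>2 * of_int m) + (- b / (a\<^sup>2 - b\<^sup>2 * of_int m)) * d"
proof -
  have "a - b * d \<noteq> 0"
    using rational_coords_unique[of a "- b" 0 0] assms by auto
  then have "(a + b * d) * (a - b * d) \<noteq> 0"
    using assms(3) by simp
  moreover have norm: "(a + b * d) * (a - b * d) = a\<^sup>2 - b\<^sup>2 * of_int m"
    using coords_mult[of a b a "- b"] by (simp add: power2_eq_square)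
  ultimately have nz: "a\<^sup>2 - b\<^sup>2 * of_int m \<noteq> 0"
    by simp
  have "a / (a\<^sup>2 - b\<^sup>2 * of_int m) + (- b / (a\<^sup>2 - b\<^sup>2 * of_int m)) * d
      = (a - b * d) / (a\<^sup>2 - b\<^sup>2 * of_int m)"
    by (simp add: diff_divide_distrib)
  then have "(a + b * d) * (a / (a\<^sup>2 - b\<^sup>2 * of_int m) + (- b / (a\<^sup>2 - b\<^sup>2 * of_int m)) * d)
      = (a + b * d) * (a - b * d) / (a\<^sup>2 - b\<^sup>2 * of_int m)"
    by simp
  also have "\<dots> = 1"
    using nz norm by simp
  finally show ?thesis
    by (rule inverse_unique)
qed

lemma quadratic_field_eq: "quadratic_field m = {a + b * d | a b. a \<in> \<rat> \<and> b \<in> \<rat>}"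
proof
  show "quadratic_field m \<subseteq> {a + b * d | a b. a \<in> \<rat> \<and> b \<in> \<rat>}"
  proof
    fix x assume "x \<in> quadratic_field m"
    then have "x \<in> generate_field real_ring (insert d \<rat>)"
      by (simp add: quadratic_field_def d_eq)
    then have "\<exists>a b. x = a + b * d \<and> a \<in> \<rat> \<and> b \<in> \<rat>"
    proof (induction rule: generate_field.induct)
      case one
      show ?case
        by (intro exI[of _ 1] exI[of _ 0]) (simp add: ring_of_type_algebra_def)
    next
      case (incl h)
      then consider "h = d" | "h \<in> \<rat>" by blast
      then show ?case
      proof cases
        case 1
        show ?thesis by (intro exI[of _ 0] exI[of _ 1]) (simp add: 1)
      next
        case 2
        show ?thesis by (intro exI[of _ h] exI[of _ 0]) (simp add: 2)
      qed
    next
      case (a_inv h)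
      then obtain a b where "h = a + b * d" "a \<in> \<rat>" "b \<in> \<rat>" by blast
      then show ?case
        by (intro exI[of _ "- a"] exI[of _ "- b"]) (simp add: real_ring_minus)
    next
      case (m_inv h)
      then obtain a b where ab: "h = a + b * d" "a \<in> \<rat>" "b \<in> \<rat>" by blast
      moreover have "h \<noteq> 0"
        using m_inv by (simp add: ring_of_type_algebra_def)
      ultimately have "inv\<^bsub>real_ring\<^esub> h = a / (a\<^sup>2 - b\<^sup>2 * of_int m) + (- b / (a\<^sup>2 - b\<^sup>2 * of_int m)) * d"
        using inverse_coords real_ring_inv by simp
      then show ?case
        \<comment> \<open>\<open>assumption\<close> matches the equation just derived, which
          supplies both witnesses.\<close>
        using ab by (intro exI conjI) (assumption | simp)+
    next
      case (eng_add h1 h2)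
      then obtain a b a' b' where "h1 = a + b * d" "a \<in> \<rat>" "b \<in> \<rat>"
        "h2 = a' + b' * d" "a' \<in> \<rat>" "b' \<in> \<rat>" by blast
      then show ?case
        by (intro exI[of _ "a + a'"] exI[of _ "b + b'"])
          (simp add: ring_of_type_algebra_def algebra_simps)
    next
      case (eng_mult h1 h2)
      then obtain a b a' b' where "h1 = a + b * d" "a \<in> \<rat>" "b \<in> \<rat>"
        "h2 = a' + b' * d" "a' \<in> \<rat>" "b' \<in> \<rat>" by blast
      then show ?case
        by (intro exI[of _ "a * a' + b * b' * of_int m"] exI[of _ "a * b' + a' * b"])
          (simp add: ring_of_type_algebra_def coords_mult)
    qed
    then show "x \<in> {a + b * d | a b. a \<in> \<rat> \<and> b \<in> \<rat>}" by blast
  qed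
next
  show "{a + b * d | a b. a \<in> \<rat> \<and> b \<in> \<rat>} \<subseteq> quadratic_field m"
  proof clarify
    fix a b :: real assume "a \<in> \<rat>" "b \<in> \<rat>"
    then have "a \<oplus>\<^bsub>real_ring\<^esub> (b \<otimes>\<^bsub>real_ring\<^esub> d) \<in> quadratic_field m"
      unfolding quadratic_field_def d_eq
      by (intro generate_field.eng_add generate_field.eng_mult generate_field.incl) auto
    then show "a + b * d \<in> quadratic_field m"
      by (simp add: ring_of_type_algebra_def)
  qed
qed

text \<open>A nontrivial automorphism, needed to show that the identity does not generate the
  group.\<close>

lemma conjugation_in_galois_group:
  obtains f where "f \<in> carrier (galois_group (quadratic_field m) \<rat>)" "f d = - d"
proof -
  let ?K = "quadratic_field m"
  \<comment> \<open>\<open>THE\<close> is legitimate because rational coordinates are unique; the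
    restriction to \<open>?K\<close> makes \<open>f\<close> extensional.\<close>
  define f where "f = (\<lambda>x\<in>?K. THE y. \<exists>a\<in>\<rat>. \<exists>b\<in>\<rat>. x = a + b * d \<and> y = a - b * d)"
  have f: "f (a + b * d) = a - b * d" if "a \<in> \<rat>" "b \<in> \<rat>" for a b
  proof -
    have "(THE y. \<exists>a'\<in>\<rat>. \<exists>b'\<in>\<rat>. a + b * d = a' + b' * d \<and> y = a' - b' * d) = a - b * d"
      using that rational_coords_unique by (intro the_equality) blast+
    moreover have "a + b * d \<in> ?K"
      using that quadratic_field_eq by blast
    ultimately show ?thesis
      by (simp add: f_def)
  qed
  have fQ: "f a = a" if "a \<in> \<rat>" for a
    using f[of a 0] that by simp
  have fK: "f x \<in> ?K" and ff: "f (f x) = x" if x: "x \<in> ?K" for x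
  proof -
    obtain a b where ab: "x = a + b * d" "a \<in> \<rat>" "b \<in> \<rat>"
      using x quadratic_field_eq by blast
    then have fx: "f x = a + (- b) * d"
      using f by simp
    then show "f x \<in> ?K"
      using ab Rats_minus_iff quadratic_field_eq by blast
    show "f (f x) = x"
      using fx f[of a "- b"] ab by simp
  qed
  have bij: "bij_betw f ?K ?K"
    by (rule bij_betw_byWitness[where f' = f]) (use fK ff in auto)
  have hom: "f (x + y) = f x + f y \<and> f (x * y) = f x * f y" if x: "x \<in> ?K" and y: "y \<in> ?K" for x y
  proof -
    obtain a b where ab: "x = a + b * d" "a \<in> \<rat>" "b \<in> \<rat>"
      using x quadratic_field_eq by blast
    obtain a' b' where ab': "y = a' + b' * d" "a' \<in> \<rat>" "b' \<in> \<rat>"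
      using y quadratic_field_eq by blast
    have "x + y = (a + a') + (b + b') * d"
      using ab ab' by (simp add: algebra_simps)
    then have "f (x + y) = (a + a') - (b + b') * d"
      using f[of "a + a'" "b + b'"] ab ab' by (metis Rats_add)
    also have "\<dots> = f x + f y"
      using f ab ab' by (simp add: algebra_simps)
    finally have add: "f (x + y) = f x + f y" .
    have "x * y = (a * a' + b * b' * of_int m) + (a * b' + a' * b) * d"
      using ab(1) ab'(1) coords_mult by simp
    then have "f (x * y) = (a * a' + b * b' * of_int m) - (a * b' + a' * b) * d"
      using f ab ab' by simp
    also have "\<dots> = (a + (- b) * d) * (a' + (- b') * d)"
      unfolding coords_mult by (simp add: algebra_simps)
    also have "\<dots> = f x * f y"
      using f ab ab' by simp
    finally show ?thesis
      using add by blast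
  qed
  have "f \<in> carrier (galois_group ?K \<rat>)"
    unfolding galois_group_carrier using bij hom fQ by (auto simp: f_def)
  moreover have "f d = - d"
    using f[of 0 1] by simp
  ultimately show thesis
    using that by blast
qed

text \<open>\<open>\<sigma> d\<close> is a square root of \<open>m\<close>. If it were
  \<open>d\<close>, then \<open>\<sigma>\<close> would be the identity and generate only
  itself.\<close>

lemma generator_conj_root:
  assumes "is_group_generator (galois_group (quadratic_field m) \<rat>) \<sigma>"
  shows "\<sigma> \<in> carrier (galois_group (quadratic_field m) \<rat>)" and "\<sigma> d = - d"
proof -
  let ?K = "quadratic_field m"
  let ?G = "galois_group ?K \<rat>"
  show s: "\<sigma> \<in> carrier ?G"
    using assms by (simp add: is_group_generator_def)
  then have hom: "\<And>x y. x \<in> ?K \<Longrightarrow> y \<in> ?K \<Longrightarrow> \<sigma> (x + y) = \<sigma> x + \<sigma> y"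
    "\<And>x y. x \<in> ?K \<Longrightarrow> y \<in> ?K \<Longrightarrow> \<sigma> (x * y) = \<sigma> x * \<sigma> y"
    and fixQ: "\<And>x. x \<in> \<rat> \<Longrightarrow> \<sigma> x = x" and ext: "\<sigma> \<in> extensional ?K"
    unfolding galois_group_carrier by auto
  have Q: "a \<in> ?K" if "a \<in> \<rat>" for a
    using that Rats_0 unfolding quadratic_field_eq by force
  have dK: "d \<in> ?K"
    unfolding quadratic_field_eq using Rats_0 Rats_1 by force
  have "\<sigma> d * \<sigma> d = d * d"
    using hom(2)[OF dK dK] fixQ d_square by (metis Rats_of_int)
  then have "\<sigma> d = d \<or> \<sigma> d = - d"
    by (simp only: square_eq_iff)
  moreover have "\<sigma> d \<noteq> d"
  proof
    assume sd: "\<sigma> d = d"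
    have one: "\<one>\<^bsub>?G\<^esub> = (\<lambda>x\<in>?K. x)"
      by (simp add: galois_group_def BijGroup_def)
    have "\<sigma> x = x" if x: "x \<in> ?K" for x
    proof -
      obtain a b where ab: "x = a + b * d" "a \<in> \<rat>" "b \<in> \<rat>"
        using x quadratic_field_eq by blast
      have "0 + b * d \<in> ?K"
        using ab Rats_0 unfolding quadratic_field_eq by blast
      then have "b * d \<in> ?K"
        by simp
      then show ?thesis
        using ab Q dK hom fixQ sd by simp
    qed
    then have "\<sigma> = (\<lambda>x\<in>?K. x)"
      using ext by (auto simp: extensional_def)
    then have s1: "\<sigma> = \<one>\<^bsub>?G\<^esub>"
      using one by simp
    have one_in: "\<one>\<^bsub>?G\<^esub> \<in> carrier ?G"
      using s s1 by simp
    \<comment> \<open>The group axioms are not established for \<open>?G\<close>; unit laws and the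
      inverse of the unit suffice to compute what the unit generates.\<close>
    have lunit: "\<one>\<^bsub>?G\<^esub> \<otimes>\<^bsub>?G\<^esub> g = g" and runit: "g \<otimes>\<^bsub>?G\<^esub> \<one>\<^bsub>?G\<^esub> = g" if "g \<in> carrier ?G" for g
    proof -
      have g: "g \<in> Bij ?K"
        using that by (simp add: galois_group_def)
      then show "\<one>\<^bsub>?G\<^esub> \<otimes>\<^bsub>?G\<^esub> g = g" "g \<otimes>\<^bsub>?G\<^esub> \<one>\<^bsub>?G\<^esub> = g"
        using id_Bij[of ?K] Bij_imp_funcset[OF g] Bij_imp_extensional[OF g]
        by (simp_all add: galois_group_def BijGroup_def)
    qed
    have inv_one: "inv\<^bsub>?G\<^esub> \<one>\<^bsub>?G\<^esub> = \<one>\<^bsub>?G\<^esub>"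
      unfolding m_inv_def using one_in lunit by (intro the_equality) auto
    have "g = \<one>\<^bsub>?G\<^esub>" if "g \<in> generate ?G {\<one>\<^bsub>?G\<^esub>}" for g
      using that by (induction rule: generate.induct) (use one_in lunit inv_one in auto)
    moreover obtain f where "f \<in> carrier ?G" "f d = - d"
      using conjugation_in_galois_group by blast
    moreover have "carrier ?G = generate ?G {\<one>\<^bsub>?G\<^esub>}"
      using assms s1 by (simp add: is_group_generator_def)
    ultimately have "\<one>\<^bsub>?G\<^esub> d = - d"
      by metis
    then show False
      using one dK m(1) d_square by auto
  qed
  ultimately show "\<sigma> d = - d"
    by blast
qed

end

lemma quadratic_conjugation_generator:
  assumes "is_group_generator (galois_group (quadratic_field m) \<rat>) \<sigma>"
    and "m > 1" "squarefree m"
  shows "quadratic_conjugation (quadratic_field m) \<sigma> (sqrt (of_int m))"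
proof -
  let ?K = "quadratic_field m"
  define d where "d = sqrt (of_int m)"
  note m = assms(2,3) d_def
  note s = generator_conj_root[OF m assms(1)]
  note K_eq = quadratic_field_eq[OF m]
  have carrier: "\<sigma> x \<in> ?K" "\<sigma> (x + y) = \<sigma> x + \<sigma> y" "\<sigma> (x * y) = \<sigma> x * \<sigma> y"
    if "x \<in> ?K" "y \<in> ?K" for x y
    using s(1) that unfolding galois_group_carrier by (auto simp: bij_betw_def)
  have fixQ: "\<sigma> x = x" if "x \<in> \<rat>" for x
    using s(1) that unfolding galois_group_carrier by blast
  have K_I: "a + b * d \<in> ?K" if "a \<in> \<rat>" "b \<in> \<rat>" for a b
    using that unfolding K_eq by blast
  have Q: "x \<in> ?K" if "x \<in> \<rat>" for x
    using K_I[of x 0] that by simp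
  have dK: "d \<in> ?K"
    using K_I[of 0 1] by simp
  have s_coords: "\<sigma> (a + b * d) = a + (- b) * d" if "a \<in> \<rat>" "b \<in> \<rat>" for a b
    using that carrier(2)[of a "b * d"] carrier(3)[of b d] Q dK fixQ s(2) K_I[of 0 b] by simp
  show ?thesis
    unfolding d_def[symmetric]
  proof
    show "\<rat> \<subseteq> ?K"
      using Q by blast
    show "d \<in> ?K" "\<sigma> d = - d"
      by (fact dK, fact s(2))
  next
    fix x y assume x: "x \<in> ?K" and y: "y \<in> ?K"
    then show "\<sigma> (x + y) = \<sigma> x + \<sigma> y" "\<sigma> (x * y) = \<sigma> x * \<sigma> y"
      using carrier by blast+
    show "x + y \<in> ?K" "x * y \<in> ?K"
      using generate_field.eng_add[of x real_ring _ y] generate_field.eng_mult[of x real_ring _ y] x y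
      unfolding quadratic_field_def by (simp_all add: ring_of_type_algebra_def)
  next
    fix x assume x: "x \<in> ?K"
    then obtain a b where ab: "x = a + b * d" "a \<in> \<rat>" "b \<in> \<rat>"
      using K_eq by blast
    show "\<sigma> x \<in> ?K"
      using carrier(1) x by blast
    show "\<sigma> (\<sigma> x) = x"
      using ab s_coords[of a b] s_coords[of a "- b"] by simp
    show "\<sigma> x = x \<longleftrightarrow> x \<in> \<rat>"
    proof
      assume "\<sigma> x = x"
      then have "a + b * d = a + (- b) * d"
        using ab s_coords[of a b] by simp
      then have "b = - b"
        using rational_coords_unique[OF m, of a b a "- b"] ab(2,3) by simp
      then show "x \<in> \<rat>"
        using ab by simp
    qed (rule fixQ)
    show "inverse x \<in> ?K"
    proof (cases "x = 0")
      case False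
      have "inv\<^bsub>real_ring\<^esub> x \<in> generate_field real_ring (insert (sqrt (of_int m)) \<rat>)"
        using x False unfolding quadratic_field_def
        by (intro generate_field.m_inv) (simp_all add: ring_of_type_algebra_def)
      then show ?thesis
        using real_ring_inv[OF False] by (simp add: quadratic_field_def)
    qed (use x in simp)
  qed
qed

section \<open>Triangles\<close>

lemma triangle_with_angle_cosine:
  assumes "triangle_with_angle \<theta> U V W A B C"
  shows "W\<^sup>2 = U\<^sup>2 + V\<^sup>2 - 2 * U * V * cos \<theta>"
proof -
  have ne: "A \<noteq> C" "B \<noteq> C"
    using assms by (auto simp: triangle_with_angle_def insert_commute)
  have d: "norm (A - C) = U" "norm (B - C) = V" "norm (A - B) = W"
    using assms by (auto simp: triangle_with_angle_def dist_norm norm_minus_commute)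
  have pos: "U > 0" "V > 0"
    using ne d by auto
  \<comment> \<open>Cauchy-Schwarz puts the argument of \<open>arccos\<close> in
    \<open>angle_at\<close> into [-1, 1], so that \<open>cos\<close> undoes it.\<close>
  have "\<bar>(A - C) \<bullet> (B - C)\<bar> \<le> U * V"
    using Cauchy_Schwarz_ineq2[of "A - C" "B - C"] d by simp
  then have "\<bar>((A - C) \<bullet> (B - C)) / (U * V)\<bar> \<le> 1"
    using pos by simp
  then have "cos \<theta> = ((A - C) \<bullet> (B - C)) / (U * V)"
    using assms d by (auto simp: triangle_with_angle_def angle_at_def cos_arccos_abs)
  then have "U * V * cos \<theta> = (A - C) \<bullet> (B - C)"
    using pos by simp
  moreover have "W\<^sup>2 = U\<^sup>2 + V\<^sup>2 - 2 * ((A - C) \<bullet> (B - C))"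
    unfolding d[symmetric] power2_norm_eq_inner by (simp add: inner_diff inner_commute algebra_simps)
  ultimately show ?thesis
    by simp
qed

text \<open>Heron's radicand is a difference of squares that the law of cosines turns into a perfect
  square; the range of \<open>\<theta>\<close> makes its root nonnegative.\<close>

lemma measure_triangle_with_angle:
  assumes "triangle_with_angle \<theta> U V W A B C" "0 \<le> \<theta>" "\<theta> \<le> pi"
  shows "measure lborel (convex hull {A, B, C}) = U * V * sin \<theta> / 2"
proof -
  have pos: "U \<ge> 0" "V \<ge> 0"
    using assms by (auto simp: triangle_with_angle_def)
  have d: "dist B C = V" "dist A C = U" "dist A B = W"
    using assms by (auto simp: triangle_with_angle_def dist_commute)
  have "measure lborel (convex hull {A, B, C})
      = sqrt ((V + U + W) / 2 * ((V + U + W) / 2 - V) * ((V + U + W) / 2 - U) * ((V + U + W) / 2 - W))"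
    using heron[of A B C] unfolding d by simp
  also have "(V + U + W) / 2 * ((V + U + W) / 2 - V) * ((V + U + W) / 2 - U) * ((V + U + W) / 2 - W)
      = (4 * U\<^sup>2 * V\<^sup>2 - (U\<^sup>2 + V\<^sup>2 - W\<^sup>2)\<^sup>2) / 16"
    by (simp add: field_simps power2_eq_square)
  also have "\<dots> = (U * V * sin \<theta> / 2)\<^sup>2"
    unfolding triangle_with_angle_cosine[OF assms(1)]
    by (simp add: power_divide power_mult_distrib sin_squared_eq algebra_simps)
  finally show ?thesis
    using pos sin_ge_zero[OF assms(2,3)] by simp
qed

text \<open>Needed to turn a rational solution of the equations into an actual triangle:
  \<open>C\<close> at the origin, \<open>A\<close> on the first axis, \<open>B\<close> at angle
  \<open>\<theta>\<close>.\<close>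

lemma triangle_with_angle_exists:
  assumes "0 < \<theta>" "\<theta> < pi" "U > 0" "V > 0" "W \<ge> 0"
    and W: "W\<^sup>2 = U\<^sup>2 + V\<^sup>2 - 2 * U * V * cos \<theta>"
  obtains A B C where "triangle_with_angle \<theta> U V W A B C"
proof -
  define A B C :: "real ^ 2" where "A = vector [U, 0]" and "B = vector [V * cos \<theta>, V * sin \<theta>]"
    and "C = 0"
  have sin: "sin \<theta> > 0"
    using assms sin_gt_zero by blast
  have trig: "(V * cos \<theta>)\<^sup>2 + (V * sin \<theta>)\<^sup>2 = V\<^sup>2"
    by (simp add: power_mult_distrib flip: distrib_left)
  have norms: "norm A = U" "norm B = V"
    using assms trig unfolding A_def B_def by (simp_all add: norm_vec_def L2_set_def sum_2)
  have "norm (A - B) = sqrt ((U - V * cos \<theta>)\<^sup>2 + (V * sin \<theta>)\<^sup>2)"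
    unfolding A_def B_def by (simp add: norm_vec_def L2_set_def sum_2)
  also have "(U - V * cos \<theta>)\<^sup>2 + (V * sin \<theta>)\<^sup>2 = W\<^sup>2"
    using W trig by (simp add: power2_diff)
  finally have AB: "norm (A - B) = W"
    using assms(5) by (simp only: real_sqrt_abs abs_of_nonneg)
  have "A \<bullet> B = U * V * cos \<theta>"
    unfolding A_def B_def by (simp add: inner_vec_def sum_2)
  then have angle: "angle_at C A B = \<theta>"
    using assms norms by (simp add: angle_at_def C_def arccos_cos)
  have "\<not> collinear {A, B, C}"
  proof
    assume "collinear {A, B, C}"
    then have "collinear {0, A, B}"
      by (simp add: C_def insert_commute)
    then obtain c where "B = c *\<^sub>R A"
      using norms assms(3,4) unfolding collinear_lemma by auto
    then have "B $ 2 = c * A $ 2"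
      by simp
    then show False
      using sin assms(4) by (simp add: A_def B_def)
  qed
  then have "triangle_with_angle \<theta> U V W A B C"
    using angle norms AB by (simp add: triangle_with_angle_def dist_norm C_def)
  then show thesis
    using that by blast
qed

lemma field_theta_triangle_iff:
  fixes r s :: int and n :: nat
  assumes "0 < \<theta>" "\<theta> < pi" "cos \<theta> = of_int s / of_int r" "r > 0" "U > 0" "V > 0" "W > 0"
  shows "field_theta_triangle F \<theta> r s n U V W \<longleftrightarrow> U \<in> F \<and> V \<in> F \<and> W \<in> F
    \<and> U * V = 2 * of_int r * real n \<and> W\<^sup>2 = U\<^sup>2 + V\<^sup>2 - 4 * of_int s * real n"
proof -
  have sin_pos: "sin \<theta> > 0"
    using assms sin_gt_zero by blast
  \<comment> \<open>With this, \<open>sin \<theta>\<close> cancels from the area condition.\<close>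
  have alpha: "alpha r s = of_int r * sin \<theta>"
  proof -
    have "of_int (r\<^sup>2 - s\<^sup>2) = (of_int r * sin \<theta>)\<^sup>2"
      using assms(3,4) by (simp add: power_mult_distrib sin_squared_eq power_divide right_diff_distrib)
    then show ?thesis
      unfolding alpha_def using assms(4) sin_pos by simp
  qed
  have area: "U * V * sin \<theta> / 2 = real n * alpha r s \<longleftrightarrow> U * V = 2 * of_int r * real n"
    unfolding alpha using sin_pos by (auto simp: field_simps)
  have cosine: "2 * U * V * cos \<theta> = 4 * of_int s * real n" if "U * V = 2 * of_int r * real n"
    using that assms(3,4) by (simp add: mult.assoc)
  show ?thesis
  proof
    assume t: "field_theta_triangle F \<theta> r s n U V W"
    then obtain A B C where ABC: "triangle_with_angle \<theta> U V W A B C"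
      "measure lborel (convex hull {A, B, C}) = real n * alpha r s"
      by (auto simp: field_theta_triangle_def)
    then have "U * V = 2 * of_int r * real n"
      using measure_triangle_with_angle[OF ABC(1)] assms area by simp
    then show "U \<in> F \<and> V \<in> F \<and> W \<in> F
      \<and> U * V = 2 * of_int r * real n \<and> W\<^sup>2 = U\<^sup>2 + V\<^sup>2 - 4 * of_int s * real n"
      using t triangle_with_angle_cosine[OF ABC(1)] cosine by (simp add: field_theta_triangle_def)
  next
    assume t: "U \<in> F \<and> V \<in> F \<and> W \<in> F
      \<and> U * V = 2 * of_int r * real n \<and> W\<^sup>2 = U\<^sup>2 + V\<^sup>2 - 4 * of_int s * real n"
    then obtain A B C where ABC: "triangle_with_angle \<theta> U V W A B C"
      using triangle_with_angle_exists[of \<theta> U V W] assms cosine by (metis less_imp_le)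
    then have "measure lborel (convex hull {A, B, C}) = real n * alpha r s"
      using measure_triangle_with_angle[OF ABC] assms area t by simp
    then show "field_theta_triangle F \<theta> r s n U V W"
      using t ABC by (auto simp: field_theta_triangle_def)
  qed
qed

theorem theorem1p2:
  fixes m r s :: int and n :: nat and \<theta> U V W :: real
    and K :: "real set" and \<sigma> :: "real \<Rightarrow> real"
  assumes "m > 1" and "squarefree m"
    and "K = quadratic_field m"
    and "is_group_generator (galois_group K \<rat>) \<sigma>"
    and "0 < \<theta>" and "\<theta> < pi"
    and "cos \<theta> = of_int s / of_int r"
    and "0 < \<bar>s\<bar>" and "\<bar>s\<bar> < r" and "gcd r s = 1"
    and "n > 0"
    and "\<not> theta_congruent \<theta> r s n"
    and "field_theta_triangle K \<theta> r s n U V W"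
    and "U \<in> K - {0}" and "V \<in> K - {0}" and "W \<in> K - {0}"
    and "0 < U" and "U \<le> V" and "V < W"
  shows "(U * sqrt (of_int m) \<in> \<rat> \<and> V * sqrt (of_int m) \<in> \<rat> \<and> W * sqrt (of_int m) \<in> \<rat>)
       \<or> (U \<in> \<rat> \<and> V \<in> \<rat> \<and> W * sqrt (of_int m) \<in> \<rat>)
       \<or> (U \<in> K - \<rat> \<and> V \<in> K - \<rat> \<and> \<sigma> U = V \<and> W \<in> \<rat>)
       \<or> (U \<in> K - \<rat> \<and> V \<in> K - \<rat> \<and> \<sigma> U = - V \<and> W \<in> \<rat>)"
proof -
  \<comment> \<open>Thus \<open>p + q = 2 r n\<close> and \<open>p - q = 2 s n\<close>; both are
    positive because \<open>\<bar>s\<bar> < r\<close>.\<close>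
  define p q where "p = of_int (r + s) * real n" and "q = of_int (r - s) * real n"
  have r: "r > 0"
    using assms by linarith
  have pq: "p > 0" "q > 0" "p \<in> \<rat>" "q \<in> \<rat>"
    using assms(8,9,11) by (auto simp: p_def q_def zero_less_mult_iff)
  have eqs: "u * v = 2 * of_int r * real n \<and> w\<^sup>2 = u\<^sup>2 + v\<^sup>2 - 4 * of_int s * real n
    \<longleftrightarrow> u * v = p + q \<and> w\<^sup>2 = (u + v)\<^sup>2 - 4 * p" for u v w
    unfolding p_def q_def by (auto simp: power2_sum algebra_simps)
  note iff = field_theta_triangle_iff[OF assms(5-7) r, where n = n, unfolded eqs]
  have W: "W > 0"
    using assms by simp
  have V: "V > 0"
    using assms by simp
  interpret quadratic_conjugation K \<sigma> "sqrt (of_int m)"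
    using quadratic_conjugation_generator assms(1-4) by simp
  have no_triangle: False if "u \<in> \<rat>" "v \<in> \<rat>" "w \<in> \<rat>" "u > 0" "v > 0" "w > 0" "u * v = p + q"
    "w\<^sup>2 = (u + v)\<^sup>2 - 4 * p" for u v w
    using assms(11,12) iff[OF that(4-6), of \<rat>] that unfolding theta_congruent_def by metis
  have "U * V = p + q" "W\<^sup>2 = (U + V)\<^sup>2 - 4 * p" "U \<in> K" "V \<in> K" "W \<in> K"
    using assms(13) iff[OF assms(17) V W, of K] by blast+
  then show ?thesis
    by (intro triangle_types[OF pq _ _ _ _ assms(17) V W]) (rule no_triangle)
qed

end
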